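(* Let $n,\ell\ge 1$ and define $\phi:\mathbb{R}^{n\times \ell}\to \mathbb{R}^{\ell\times \ell}$ by $\phi(A)=\sqrt{A^{t}A}$, where $\sqrt{A^tA}$ is the unique positive semi-definite matrix whose square is $A^tA$. Then $$d_{\mathrm{O}(n)}(A,B)\leq d(\phi(A),\phi(B))\leq \sqrt{2}\,d_{\mathrm{O}(n)}(A,B)$$ for all $A,B\in\mathbb{R}^{n\times\ell}$. The image of $\phi$ is contained in the subspace $S^2(\mathbb{R}^\ell)\subseteq\mathbb{R}^{\ell\times\ell}$ of dimension $\binom{\ell+1}{2}$ consisting of all symmetric matrices.
   Context: On real matrix spaces, $\langle A,B\rangle=\operatorname{trace}(AB^{t})$, $\|A\|=\sqrt{\langle A,A\rangle}$ (Frobenius norm) and $d(A,B)=\|A-B\|$. The orthogonal group $\mathrm{O}(n)$ acts on $\mathbb{R}^{n\times\ell}$ by left multiplication, and $d_{\mathrm{O}(n)}(A,B)=\min_{g\in \mathrm{O}(n)}\|gA-B\|$. *)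

theory Defs
  imports "HOL-Analysis.Analysis"
begin

definition frob_inner :: "real^'m^'n \<Rightarrow> real^'m^'n \<Rightarrow> real" where
  "frob_inner A B = trace (A ** transpose B)"

definition frob_norm :: "real^'m^'n \<Rightarrow> real" where
  "frob_norm A = sqrt (frob_inner A A)"

definition frob_dist :: "real^'m^'n \<Rightarrow> real^'m^'n \<Rightarrow> real" where
  "frob_dist A B = frob_norm (A - B)"

lemma frob_inner_eq_inner: "frob_inner A B = A \<bullet> B"
  by (simp add: frob_inner_def trace_def matrix_matrix_mult_def transpose_def inner_vec_def)

lemma frob_norm_eq_norm: "frob_norm A = norm A"
  by (simp add: frob_norm_def frob_inner_eq_inner norm_eq_sqrt_inner)

lemma frob_dist_eq_dist: "frob_dist A B = dist A B"
  by (simp add: frob_dist_def frob_norm_eq_norm dist_norm)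

text \<open>The distance of two orbits of the left action of the orthogonal group. It is written as an
  infimum; the lemma \<open>orth_dist_attained\<close> below shows that the infimum is a minimum.\<close>

definition orth_dist :: "real^'m^'n \<Rightarrow> real^'m^'n \<Rightarrow> real" where
  "orth_dist A B = (INF g \<in> {g :: real^'n^'n. orthogonal_matrix g}. frob_dist (g ** A) B)"

lemma compact_orthogonal_matrices: "compact {g :: real^'n^'n. orthogonal_matrix g}"
proof -
  have "norm g \<le> sqrt (real CARD('n))" if "orthogonal_matrix g" for g :: "real^'n^'n"
  proof -
    have "frob_inner g g = real CARD('n)"
      using that by (simp add: frob_inner_def orthogonal_matrix_def trace_def mat_def)
    then show ?thesis
      by (metis frob_norm_def frob_norm_eq_norm order_refl)
  qed
  then have "bounded {g :: real^'n^'n. orthogonal_matrix g}"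
    by (auto simp: bounded_iff)
  moreover have "closed {g :: real^'n^'n. orthogonal_matrix g}"
    unfolding orthogonal_matrix matrix_matrix_mult_def transpose_def
    by (intro closed_Collect_eq continuous_intros)
  ultimately show ?thesis
    by (simp add: compact_eq_bounded_closed)
qed

lemma orth_dist_attained:
  fixes A B :: "real^'m^'n"
  shows "\<exists>g. orthogonal_matrix g \<and> orth_dist A B = frob_dist (g ** A) B
           \<and> (\<forall>h. orthogonal_matrix h \<longrightarrow> frob_dist (g ** A) B \<le> frob_dist (h ** A) B)"
proof -
  let ?O = "{g :: real^'n^'n. orthogonal_matrix g}"
  have "continuous_on ?O (\<lambda>g. frob_dist (g ** A) B)"
    unfolding frob_dist_eq_dist matrix_matrix_mult_def by (intro continuous_intros)
  moreover have "?O \<noteq> {}"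
    using orthogonal_matrix_id by blast
  ultimately obtain g where g: "g \<in> ?O"
      and min: "\<And>h. h \<in> ?O \<Longrightarrow> frob_dist (g ** A) B \<le> frob_dist (h ** A) B"
    using continuous_attains_inf[OF compact_orthogonal_matrices] by metis
  have "orth_dist A B = frob_dist (g ** A) B"
    unfolding orth_dist_def by (rule cInf_eq_minimum) (use g min in auto)
  then show ?thesis
    using g min by auto
qed

definition symmetric_matrices :: "(real^'n^'n) set" where
  "symmetric_matrices = {S. transpose S = S}"

definition pos_semidef :: "real^'n^'n \<Rightarrow> bool" where
  "pos_semidef S \<longleftrightarrow> transpose S = S \<and> (\<forall>x. 0 \<le> x \<bullet> (S *v x))"

definition psd_sqrt :: "real^'n^'n \<Rightarrow> real^'n^'n" where
  "psd_sqrt M = (THE S. pos_semidef S \<and> S ** S = M)"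

definition phi :: "real^'l^'n \<Rightarrow> real^'l^'l" where
  "phi A = psd_sqrt (transpose A ** A)"

end

theory Submission imports Defs begin

text \<open>
  Write \<open>P = phi A\<close>, \<open>Q = phi B\<close>. Since \<open>norm P = norm A\<close> and \<open>norm Q = norm B\<close>, both bounds are statements
  about inner products. Let \<open>A v\<^sub>i = s\<^sub>i u\<^sub>i\<close> and \<open>B x\<^sub>j = t\<^sub>j y\<^sub>j\<close> be singular value decompositions, so that
  \<open>P v\<^sub>i = s\<^sub>i v\<^sub>i\<close> and \<open>Q x\<^sub>j = t\<^sub>j x\<^sub>j\<close>.

  Upper bound: \<open>\<langle>A, B\<rangle>\<close> is the sum of \<open>s\<^sub>i t\<^sub>j \<langle>v\<^sub>i, x\<^sub>j\<rangle> \<langle>u\<^sub>i, y\<^sub>j\<rangle>\<close> and \<open>\<langle>P, Q\<rangle>\<close> is the sum of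
  \<open>s\<^sub>i t\<^sub>j \<langle>v\<^sub>i, x\<^sub>j\<rangle>\<^sup>2\<close>. By AM-GM and Bessel's inequality,
  \<open>4 \<langle>A, B\<rangle> \<le> 2 \<langle>P, Q\<rangle> + \<langle>A, A\<rangle> + \<langle>B, B\<rangle>\<close>, and \<open>A\<close> may be replaced by \<open>g A\<close> as \<open>phi (g A) = phi A\<close>.

  Lower bound: \<open>P = K A\<close> and \<open>Q = L B\<close> for contractions \<open>K\<close>, \<open>L\<close>. With \<open>M = B A\<^sup>t\<close>, the number
  \<open>\<langle>P, Q\<rangle> = \<langle>K, L M\<rangle>\<close> is at most the sum of the singular values of \<open>M\<close>, which equals
  \<open>\<langle>g, M\<rangle> = \<langle>g A, B\<rangle>\<close> for the orthogonal polar factor \<open>g\<close> of \<open>M\<close>.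
\<close>

subsection \<open>Orthonormal families and the spectral theorem\<close>

definition orthonormal_on :: "'i set \<Rightarrow> ('i \<Rightarrow> 'a::real_inner) \<Rightarrow> bool" where
  "orthonormal_on N v \<longleftrightarrow> (\<forall>i\<in>N. \<forall>j\<in>N. v i \<bullet> v j = (if i = j then 1 else 0))"

text \<open>The predicate \<open>P\<close> rides along as an invariant, so one induction serves both
  completion of a family (\<open>P\<close> trivial) and construction of an eigenbasis
  (\<open>P\<close> says eigenvector).\<close>

lemma orthonormal_on_extend:
  fixes v :: "'i::finite \<Rightarrow> 'a::real_inner"
  assumes "orthonormal_on N v" "\<And>i. i \<in> N \<Longrightarrow> P (v i)"
    and step: "\<And>(N :: 'i set) v. \<lbrakk>orthonormal_on N v; \<And>i. i \<in> N \<Longrightarrow> P (v i); N \<noteq> UNIV\<rbrakk>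
      \<Longrightarrow> \<exists>x. norm x = 1 \<and> (\<forall>i\<in>N. v i \<bullet> x = 0) \<and> P x"
  shows "\<exists>w. orthonormal_on UNIV w \<and> (\<forall>i. P (w i)) \<and> (\<forall>i\<in>N. w i = v i)"
proof -
  have "\<exists>w. orthonormal_on (N \<union> M) w \<and> (\<forall>i\<in>N \<union> M. P (w i)) \<and> (\<forall>i\<in>N. w i = v i)" for M :: "'i set"
    using finite[of M]
  proof (induction M rule: finite_induct)
    case empty
    then show ?case using assms(1,2) by auto
  next
    case (insert k M)
    then obtain w where w: "orthonormal_on (N \<union> M) w" "\<forall>i\<in>N \<union> M. P (w i)" "\<forall>i\<in>N. w i = v i"
      by blast
    show ?case
    proof (cases "k \<in> N")
      case True
      then show ?thesis using w by (metis Un_insert_right insert_absorb UnI1)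
    next
      case False
      then have k: "k \<notin> N \<union> M" using insert by auto
      then obtain x where x: "norm x = 1" "\<forall>i\<in>N \<union> M. w i \<bullet> x = 0" "P x"
        using step[OF w(1)] w(2) by blast
      have "orthonormal_on (N \<union> insert k M) (w(k := x))"
        using w(1) x k by (auto simp: orthonormal_on_def inner_commute norm_eq_1)
      moreover have "\<forall>i\<in>N \<union> insert k M. P ((w(k := x)) i)" "\<forall>i\<in>N. (w(k := x)) i = v i"
        using w x k by auto
      ultimately show ?thesis by blast
    qed
  qed
  from this[of UNIV] show ?thesis by auto
qed

text \<open>Dimension count: a family indexed by a proper subset of \<open>'n\<close> spans a proper
  subspace.\<close>

lemma exists_nonzero_orthogonal:
  fixes v :: "'n::finite \<Rightarrow> real^'n"
  assumes "N \<noteq> UNIV"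
  obtains x where "x \<noteq> 0" "\<forall>i\<in>N. v i \<bullet> x = 0"
proof -
  have "dim (v ` N) \<le> card (v ` N)" by (simp add: dim_le_card')
  also have "\<dots> \<le> card N" by (simp add: card_image_le)
  also have "\<dots> < DIM(real^'n)" using assms by (simp add: psubset_card_mono psubset_eq)
  finally obtain x where "x \<noteq> 0" "\<And>y. y \<in> span (v ` N) \<Longrightarrow> orthogonal x y"
    using orthogonal_to_subspace_exists by blast
  then show ?thesis
    using that by (metis imageI inner_commute orthogonal_def span_base)
qed

lemma orthonormal_family_completion:
  fixes v :: "'n::finite \<Rightarrow> real^'n"
  assumes "orthonormal_on N v"
  shows "\<exists>w. orthonormal_on UNIV w \<and> (\<forall>i\<in>N. w i = v i)"
proof -
  have "\<exists>x. norm x = 1 \<and> (\<forall>i\<in>M. u i \<bullet> x = 0) \<and> True" if M: "M \<noteq> UNIV" for M and u :: "'n \<Rightarrow> real^'n"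
  proof -
    obtain x where "x \<noteq> 0" "\<forall>i\<in>M. u i \<bullet> x = 0"
      using exists_nonzero_orthogonal[OF M] by blast
    then show ?thesis by (intro exI[of _ "x /\<^sub>R norm x"]) auto
  qed
  then show ?thesis
    using orthonormal_on_extend[OF assms, of "\<lambda>_. True"] by simp
qed

lemma inner_mult_vec_symmetric:
  fixes S :: "real^'n^'n"
  assumes "transpose S = S"
  shows "x \<bullet> (S *v y) = (S *v x) \<bullet> y"
  using assms by (metis dot_lmul_matrix transpose_matrix_vector)

text \<open>A maximiser of the quadratic form of \<open>S\<close> on the unit sphere of
  \<open>W\<close> is an eigenvector. Invariance of \<open>W\<close> keeps the residual in
  \<open>W\<close>, where it is an admissible direction of variation.\<close>

lemma symmetric_eigenvector_exists:
  fixes S :: "real^'n^'n"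
  assumes sym: "transpose S = S" and W: "subspace W" "\<And>x. x \<in> W \<Longrightarrow> S *v x \<in> W" and ne: "y \<in> W" "y \<noteq> 0"
  shows "\<exists>x c. x \<in> W \<and> norm x = 1 \<and> S *v x = c *\<^sub>R x"
proof -
  let ?K = "sphere 0 1 \<inter> W"
  have "compact ?K"
    by (simp add: W(1) closed_subspace compact_Int_closed)
  moreover have "y /\<^sub>R norm y \<in> ?K"
    using ne W(1) by (auto simp: subspace_scale)
  moreover have "continuous_on ?K (\<lambda>x. x \<bullet> (S *v x))"
    by (intro continuous_intros)
  ultimately obtain x where x: "x \<in> ?K" and max: "\<And>z. z \<in> ?K \<Longrightarrow> z \<bullet> (S *v z) \<le> x \<bullet> (S *v x)"
    using continuous_attains_sup[of ?K "\<lambda>x. x \<bullet> (S *v x)"] by blast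
  define c where "c = x \<bullet> (S *v x)"
  have nx: "norm x = 1" using x by simp
  \<comment> \<open>By homogeneity, maximality on the sphere becomes nonnegativity of a quadratic
    form on all of \<open>W\<close>; this form vanishes at \<open>x\<close>.\<close>
  have q: "0 \<le> c * (z \<bullet> z) - z \<bullet> (S *v z)" if "z \<in> W" for z
  proof (cases "z = 0")
    case False
    have "(z /\<^sub>R norm z) \<bullet> (S *v (z /\<^sub>R norm z)) \<le> c"
      unfolding c_def using that False W(1) by (intro max) (auto simp: subspace_scale)
    then show ?thesis
      using False by (simp add: matrix_vector_mult_scaleR dot_square_norm power2_eq_square field_simps)
  qed auto
  define w where "w = c *\<^sub>R x - S *v x"
  have wW: "w \<in> W" unfolding w_def using x W by (simp add: subspace_diff subspace_scale)
  define a where "a = c * (w \<bullet> w) - w \<bullet> (S *v w)"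
  \<comment> \<open>First variation at \<open>x\<close> in the direction of the residual
    \<open>w\<close>: the linear coefficient is \<open>2 * (w \<bullet> w)\<close>, so it has to
    vanish.\<close>
  have "0 \<le> t * (2 * (w \<bullet> w) + t * a)" for t
  proof -
    have "x + t *\<^sub>R w \<in> W" using x wW W(1) by (simp add: subspace_add subspace_scale)
    from q[OF this] have "0 \<le> c * ((x + t *\<^sub>R w) \<bullet> (x + t *\<^sub>R w)) - (x + t *\<^sub>R w) \<bullet> (S *v (x + t *\<^sub>R w))" .
    also have "\<dots> = (c * (x \<bullet> x) - x \<bullet> (S *v x)) + 2 * t * (c * (x \<bullet> w) - (S *v x) \<bullet> w) + t * t * a"
      using inner_mult_vec_symmetric[OF sym, of x w]
      by (simp add: a_def matrix_vector_mult_scaleR matrix_vector_right_distrib inner_add_left inner_add_right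
          inner_commute algebra_simps)
    also have "c * (x \<bullet> x) - x \<bullet> (S *v x) = 0" using nx by (simp add: c_def norm_eq_1)
    also have "c * (x \<bullet> w) - (S *v x) \<bullet> w = w \<bullet> w" by (simp add: w_def inner_diff_left)
    finally show ?thesis by (simp add: algebra_simps)
  qed
  note pos = this
  have "w \<bullet> w = 0"
  proof (rule ccontr)
    assume "w \<bullet> w \<noteq> 0"
    then have w0: "w \<bullet> w > 0" by simp
    \<comment> \<open>Negative and so small that the quadratic term cannot compensate the linear
      one; the summand 1 avoids division by zero.\<close>
    define t where "t = - (w \<bullet> w) / (1 + \<bar>a\<bar>)"
    have "t < 0" using w0 by (simp add: t_def divide_neg_pos)
    then have "2 * (w \<bullet> w) + t * a \<le> 0"
      using pos[of t] by (simp add: zero_le_mult_iff)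
    moreover have "\<bar>t * a\<bar> \<le> w \<bullet> w"
      using w0 by (simp add: t_def abs_mult divide_simps mult_left_mono)
    ultimately show False using w0 by linarith
  qed
  then show ?thesis using x nx by (intro exI[of _ x] exI[of _ c]) (auto simp: w_def)
qed

text \<open>Eigenvectors are collected one by one: by symmetry, the orthogonal complement of those
  already found is invariant under \<open>S\<close> and so contains another.\<close>

theorem symmetric_matrix_spectral:
  fixes S :: "real^'n^'n"
  assumes sym: "transpose S = S"
  shows "\<exists>v c. orthonormal_on UNIV (v :: 'n \<Rightarrow> _) \<and> (\<forall>i. S *v v i = c i *\<^sub>R v i)"
proof -
  let ?P = "\<lambda>x. \<exists>c. S *v x = c *\<^sub>R x"
  have "\<exists>x. norm x = 1 \<and> (\<forall>i\<in>N. v i \<bullet> x = 0) \<and> ?P x"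
    if eig: "\<And>i. i \<in> N \<Longrightarrow> ?P (v i)" and N: "N \<noteq> UNIV" for N and v :: "'n \<Rightarrow> real^'n"
  proof -
    define W where "W = {x. \<forall>i\<in>N. v i \<bullet> x = 0}"
    obtain y where y: "y \<noteq> 0" "y \<in> W"
      unfolding W_def using exists_nonzero_orthogonal[OF N] by blast
    have "subspace W" by (auto simp: W_def subspace_def inner_add_right)
    moreover have "S *v x \<in> W" if "x \<in> W" for x
      using that eig by (fastforce simp: W_def inner_mult_vec_symmetric[OF sym])
    ultimately show ?thesis
      using symmetric_eigenvector_exists[OF sym _ _ y(2,1)] unfolding W_def by blast
  qed
  \<comment> \<open>The extension starts from the empty family, so \<open>undefined\<close> is a
    mere placeholder.\<close>
  then have "\<exists>w. orthonormal_on UNIV (w :: 'n \<Rightarrow> _) \<and> (\<forall>i. ?P (w i)) \<and> (\<forall>i\<in>{}. w i = undefined i)"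
    by (intro orthonormal_on_extend) (auto simp: orthonormal_on_def)
  then obtain w :: "'n \<Rightarrow> _" where "orthonormal_on UNIV w" "\<forall>i. ?P (w i)" by blast
  then show ?thesis by (metis choice)
qed

section \<open>Orthonormal expansions, Parseval and Bessel\<close>

lemma orthonormal_expansion:
  fixes v :: "'n::finite \<Rightarrow> real^'n"
  assumes "orthonormal_on UNIV v"
  shows "(\<Sum>i\<in>UNIV. (v i \<bullet> x) *\<^sub>R v i) = x"
proof -
  define U :: "real^'n^'n" where "U = (\<chi> i. v i)"
  have "U ** transpose U = mat 1"
    using assms by (simp add: orthonormal_on_def U_def matrix_matrix_mult_def transpose_def mat_def vec_eq_iff inner_vec_def)
  \<comment> \<open>A one-sided inverse of a square matrix is two-sided; applying this identity to
    \<open>x\<close> gives the expansion.\<close>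
  then have "transpose U ** U = mat 1" by (simp add: matrix_left_right_inverse)
  then have "x = transpose U *v (U *v x)" by (simp add: matrix_vector_mul_assoc)
  also have "\<dots> = (\<Sum>i\<in>UNIV. (v i \<bullet> x) *\<^sub>R v i)"
    by (simp add: U_def matrix_vector_mult_def transpose_def vec_eq_iff inner_vec_def mult.commute)
  finally show ?thesis ..
qed

lemma orthonormal_parseval:
  fixes v :: "'n::finite \<Rightarrow> real^'n"
  assumes "orthonormal_on UNIV v"
  shows "(\<Sum>i\<in>UNIV. (v i \<bullet> x) * (v i \<bullet> y)) = x \<bullet> y"
proof -
  have "x \<bullet> y = (\<Sum>i\<in>UNIV. (v i \<bullet> x) *\<^sub>R v i) \<bullet> y" by (simp add: orthonormal_expansion[OF assms])
  then show ?thesis by (simp add: inner_sum_left)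
qed

text \<open>Parseval's identity, applied to each pair of corresponding rows.\<close>

lemma matrix_inner_orthonormal:
  fixes A B :: "real^'l^'n" and v :: "'l \<Rightarrow> real^'l"
  assumes "orthonormal_on UNIV v"
  shows "A \<bullet> B = (\<Sum>i\<in>UNIV. (A *v v i) \<bullet> (B *v v i))"
proof -
  have "A \<bullet> B = (\<Sum>k\<in>UNIV. \<Sum>i\<in>UNIV. (v i \<bullet> (A $ k)) * (v i \<bullet> (B $ k)))"
    by (simp add: orthonormal_parseval[OF assms] inner_vec_def[of A B])
  also have "\<dots> = (\<Sum>i\<in>UNIV. \<Sum>k\<in>UNIV. (v i \<bullet> (A $ k)) * (v i \<bullet> (B $ k)))" by (rule sum.swap)
  also have "\<dots> = (\<Sum>i\<in>UNIV. (A *v v i) \<bullet> (B *v v i))"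
    by (simp add: inner_vec_def[where 'b='n] matrix_mult_dot inner_commute)
  finally show ?thesis .
qed

lemma matrix_eqI_orthonormal:
  fixes A B :: "real^'l^'n" and v :: "'l \<Rightarrow> real^'l"
  assumes v: "orthonormal_on UNIV v" and eq: "\<And>i. A *v v i = B *v v i"
  shows "A = B"
proof -
  have "(A - B) \<bullet> (A - B) = 0"
    by (simp add: matrix_inner_orthonormal[OF v] matrix_vector_mult_diff_rdistrib eq)
  then show ?thesis by simp
qed

text \<open>Zero vectors are allowed outside \<open>N\<close>, so that the bound applies to left
  singular vectors. It expresses that \<open>x\<close> minus its projection \<open>y\<close> has
  nonnegative square norm.\<close>

lemma bessel_partial_orthonormal:
  fixes u :: "'i::finite \<Rightarrow> 'a::real_inner"
  assumes u: "\<And>i j. u i \<bullet> u j = (if i = j \<and> i \<in> N then 1 else 0)"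
  shows "(\<Sum>i\<in>UNIV. (u i \<bullet> x)\<^sup>2) \<le> (norm x)\<^sup>2"
proof -
  let ?s = "\<Sum>i\<in>UNIV. (u i \<bullet> x)\<^sup>2"
  define y where "y = (\<Sum>i\<in>UNIV. (u i \<bullet> x) *\<^sub>R u i)"
  have z: "u i = 0" if "i \<notin> N" for i using u[of i i] that by simp
  have xy: "x \<bullet> y = ?s"
    by (simp add: y_def inner_sum_right power2_eq_square inner_commute)
  have "y \<bullet> y = (\<Sum>i\<in>UNIV. \<Sum>j\<in>UNIV. if i = j then (if i \<in> N then (u i \<bullet> x)\<^sup>2 else 0) else 0)"
    unfolding y_def inner_sum_left inner_sum_right
    by (intro sum.cong refl) (auto simp: u power2_eq_square)
  also have "\<dots> = ?s"
    by (simp add: sum.delta) (intro sum.cong refl, auto simp: z)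
  finally have "y \<bullet> y = ?s" .
  moreover have "0 \<le> (x - y) \<bullet> (x - y)" by simp
  ultimately show ?thesis
    using xy by (simp add: inner_diff_left inner_diff_right inner_commute power2_norm_eq_inner)
qed

subsection \<open>Singular values and the positive semidefinite root\<close>

text \<open>The product of \<open>u\<close> as columns, the diagonal matrix of \<open>s\<close> and
  the transpose of \<open>v\<close> as columns. Unit weights give partial isometries and orthogonal
  matrices.\<close>

definition outer_sum :: "('i::finite \<Rightarrow> real) \<Rightarrow> ('i \<Rightarrow> real^'n) \<Rightarrow> ('i \<Rightarrow> real^'m) \<Rightarrow> real^'m^'n" where
  "outer_sum s u v = (\<chi> a b. \<Sum>i\<in>UNIV. s i * u i $ a * v i $ b)"

lemma outer_sum_mult_vec: "outer_sum s u v *v x = (\<Sum>i\<in>UNIV. (s i * (v i \<bullet> x)) *\<^sub>R u i)"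
proof -
  have "(\<Sum>b\<in>UNIV. (\<Sum>i\<in>UNIV. s i * u i $ a * v i $ b) * x $ b)
      = (\<Sum>i\<in>UNIV. (s i * (\<Sum>b\<in>UNIV. v i $ b * x $ b)) * u i $ a)" for a
    unfolding sum_distrib_left sum_distrib_right by (subst sum.swap) (simp only: mult_ac)
  then show ?thesis
    by (simp add: outer_sum_def matrix_vector_mult_def vec_eq_iff inner_vec_def)
qed

lemma outer_sum_mult_orthonormal:
  assumes "orthonormal_on UNIV v"
  shows "outer_sum s u v *v v j = s j *\<^sub>R u j"
proof -
  have "outer_sum s u v *v v j = (\<Sum>i\<in>UNIV. if i = j then s i *\<^sub>R u i else 0)"
    unfolding outer_sum_mult_vec using assms by (intro sum.cong) (auto simp: orthonormal_on_def)
  then show ?thesis by simp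
qed

lemma transpose_outer_sum: "transpose (outer_sum s u v) = outer_sum s v u"
  by (simp add: outer_sum_def transpose_def mult_ac)

lemma inner_transpose_mult_vec:
  fixes A :: "real^'m^'n"
  shows "x \<bullet> (transpose A *v y) = (A *v x) \<bullet> y"
  by (metis dot_lmul_matrix inner_commute transpose_matrix_vector)

text \<open>A vector \<open>u i\<close> belonging to a zero singular value is zero, as \<open>A\<close> may have fewer rows than columns.\<close>

definition is_svd :: "real^'l^'n \<Rightarrow> ('l \<Rightarrow> real^'l) \<Rightarrow> ('l \<Rightarrow> real) \<Rightarrow> ('l \<Rightarrow> real^'n) \<Rightarrow> bool" where
  "is_svd A v s u \<longleftrightarrow> orthonormal_on UNIV v \<and> (\<forall>i. 0 \<le> s i) \<and> (\<forall>i. A *v v i = s i *\<^sub>R u i)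
     \<and> (\<forall>i j. u i \<bullet> u j = (if i = j \<and> i \<in> {i. s i \<noteq> 0} then 1 else 0))"

text \<open>Take an eigenbasis \<open>v\<close> of the Gram matrix: the images
  \<open>A *v v i\<close> are pairwise orthogonal and only need normalising.\<close>

theorem svd_exists:
  fixes A :: "real^'l^'n"
  shows "\<exists>v s u. is_svd A v s u"
proof -
  have "transpose (transpose A ** A) = transpose A ** A" by (simp add: matrix_transpose_mul)
  then obtain v :: "'l \<Rightarrow> _" and c where v: "orthonormal_on UNIV v"
    and c: "\<And>i. (transpose A ** A) *v v i = c i *\<^sub>R v i"
    using symmetric_matrix_spectral by metis
  have vv: "(A *v v i) \<bullet> (A *v v j) = (if i = j then c j else 0)" for i j
    using c[of j] v
    by (simp add: inner_transpose_mult_vec[symmetric] matrix_vector_mul_assoc orthonormal_on_def)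
  define s where "s i = norm (A *v v i)" for i
  \<comment> \<open>If \<open>s i = 0\<close>, the inverse is 0 by convention and \<open>u i\<close>
    is the zero vector, as \<open>is_svd\<close> requires.\<close>
  define u where "u i = (A *v v i) /\<^sub>R s i" for i
  have "is_svd A v s u"
    unfolding is_svd_def
  proof (intro conjI allI)
    fix i j
    show "0 \<le> s i" by (simp add: s_def)
    show "A *v v i = s i *\<^sub>R u i" by (cases "A *v v i = 0") (simp_all add: s_def u_def)
    show "u i \<bullet> u j = (if i = j \<and> i \<in> {i. s i \<noteq> 0} then 1 else 0)"
      using vv[of i j] by (auto simp: u_def s_def dot_square_norm power2_eq_square divide_simps)
  qed (rule v)
  then show ?thesis by blast
qed

lemma svd_gram_eigen:
  fixes A :: "real^'l^'n"
  assumes "is_svd A v s u"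
  shows "(transpose A ** A) *v v i = (s i)\<^sup>2 *\<^sub>R v i"
proof -
  let ?x = "(transpose A ** A) *v v i"
  have v: "orthonormal_on UNIV v" using assms by (simp add: is_svd_def)
  have "?x = (\<Sum>j\<in>UNIV. (v j \<bullet> ?x) *\<^sub>R v j)"
    using orthonormal_expansion[OF v, of ?x] by simp
  also have "\<dots> = (\<Sum>j\<in>UNIV. if j = i then (s j)\<^sup>2 *\<^sub>R v j else 0)"
    using assms
    by (intro sum.cong)
      (auto simp: is_svd_def inner_transpose_mult_vec matrix_vector_mul_assoc[symmetric] power2_eq_square
        simp del: transpose_matrix_vector)
  finally show ?thesis by simp
qed

text \<open>The residual \<open>w\<close> satisfies \<open>S *v w = - (r *\<^sub>R w)\<close>, so
  semidefiniteness forces \<open>w = 0\<close> when \<open>r > 0\<close>. This pins down every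
  semidefinite root on eigenvectors of its square.\<close>

lemma pos_semidef_root_eigen:
  assumes S: "pos_semidef S" and r: "(S ** S) *v x = r\<^sup>2 *\<^sub>R x" "0 \<le> r"
  shows "S *v x = r *\<^sub>R x"
proof -
  define w where "w = S *v x - r *\<^sub>R x"
  have sym: "transpose S = S" and pos: "0 \<le> w \<bullet> (S *v w)" using S by (auto simp: pos_semidef_def)
  have SSx: "S *v (S *v x) = r\<^sup>2 *\<^sub>R x" using r by (simp add: matrix_vector_mul_assoc)
  have Sw: "S *v w = - (r *\<^sub>R w)"
    by (simp add: w_def matrix_vector_mult_diff_distrib matrix_vector_mult_scaleR SSx algebra_simps power2_eq_square)
  show ?thesis
  proof (cases "r = 0")
    case True
    have "(S *v x) \<bullet> (S *v x) = x \<bullet> (S *v (S *v x))" by (simp add: inner_mult_vec_symmetric[OF sym])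
    then show ?thesis using SSx True by simp
  next
    case False
    have "r * (w \<bullet> w) \<le> 0" using pos Sw by simp
    then have "w = 0"
      using False r(2) by (metis inner_eq_zero_iff inner_ge_zero mult_le_0_iff order_antisym)
    then show ?thesis by (simp add: w_def)
  qed
qed

text \<open>The root keeps the right singular vectors and has the singular values as eigenvalues;
  any other root agrees with it on this basis.\<close>

lemma gram_root_ex1:
  fixes A :: "real^'l^'n"
  shows "\<exists>!S. pos_semidef S \<and> S ** S = transpose A ** A"
proof -
  obtain v s u where svd: "is_svd A v s u" using svd_exists by blast
  then have v: "orthonormal_on UNIV v" and s: "\<And>i. 0 \<le> s i" unfolding is_svd_def by blast+
  let ?S = "outer_sum s v v"
  have Sv: "?S *v v i = s i *\<^sub>R v i" for i by (rule outer_sum_mult_orthonormal[OF v])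
  have "x \<bullet> (?S *v x) = (\<Sum>i\<in>UNIV. s i * (v i \<bullet> x)\<^sup>2)" for x
    by (simp add: outer_sum_mult_vec inner_sum_right power2_eq_square inner_commute mult_ac)
  then have "pos_semidef ?S"
    by (simp add: pos_semidef_def transpose_outer_sum sum_nonneg s)
  moreover have "?S ** ?S = transpose A ** A"
    by (rule matrix_eqI_orthonormal[OF v])
      (simp add: svd_gram_eigen[OF svd] Sv matrix_vector_mult_scaleR power2_eq_square
        flip: matrix_vector_mul_assoc[of ?S ?S])
  moreover have "T = ?S" if T: "pos_semidef T" "T ** T = transpose A ** A" for T
  proof (rule matrix_eqI_orthonormal[OF v])
    show "T *v v i = ?S *v v i" for i
      using pos_semidef_root_eigen[OF T(1)] T(2) s Sv by (simp add: svd_gram_eigen[OF svd])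
  qed
  ultimately show ?thesis by blast
qed

lemma phi_pos_semidef: "pos_semidef (phi A)"
  and phi_square: "phi A ** phi A = transpose A ** A"
  using theI'[OF gram_root_ex1[of A]] unfolding phi_def psd_sqrt_def by (rule conjunct1, rule conjunct2)

lemma svd_phi_eigen:
  assumes "is_svd A v s u"
  shows "phi A *v v i = s i *\<^sub>R v i"
proof (rule pos_semidef_root_eigen[OF phi_pos_semidef])
  show "(phi A ** phi A) *v v i = (s i)\<^sup>2 *\<^sub>R v i"
    unfolding phi_square by (rule svd_gram_eigen[OF assms])
  show "0 \<le> s i" using assms by (simp add: is_svd_def)
qed

lemma svd_inner_self:
  assumes "is_svd A v s u"
  shows "A \<bullet> A = (\<Sum>i\<in>UNIV. (s i)\<^sup>2)"
proof -
  have v: "orthonormal_on UNIV v" using assms by (simp add: is_svd_def)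
  show ?thesis
    unfolding matrix_inner_orthonormal[OF v, of A]
    using assms by (intro sum.cong) (auto simp: is_svd_def power2_eq_square)
qed

lemma phi_inner_self: "phi A \<bullet> phi A = A \<bullet> A"
proof -
  obtain v s u where svd: "is_svd A v s u" using svd_exists by blast
  then have v: "orthonormal_on UNIV v" by (simp add: is_svd_def)
  show ?thesis
    unfolding matrix_inner_orthonormal[OF v, of "phi A"] svd_phi_eigen[OF svd] svd_inner_self[OF svd]
    using v by (intro sum.cong) (auto simp: orthonormal_on_def power2_eq_square)
qed

section \<open>The upper bound\<close>

lemma inner_double_expansion:
  fixes A B :: "real^'l^'n" and v x :: "'l \<Rightarrow> real^'l"
  assumes v: "orthonormal_on UNIV v" and x: "orthonormal_on UNIV x"
    and A: "\<And>i. A *v v i = s i *\<^sub>R u i" and B: "\<And>j. B *v x j = t j *\<^sub>R y j"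
  shows "A \<bullet> B = (\<Sum>i\<in>UNIV. \<Sum>j\<in>UNIV. s i * t j * ((v i \<bullet> x j) * (u i \<bullet> y j)))"
proof -
  have "B *v z = (\<Sum>j\<in>UNIV. (x j \<bullet> z) *\<^sub>R (t j *\<^sub>R y j))" for z
  proof -
    have "B *v z = B *v (\<Sum>j\<in>UNIV. (x j \<bullet> z) *\<^sub>R x j)" by (simp add: orthonormal_expansion[OF x])
    then show ?thesis
      by (simp add: linear_sum[OF matrix_vector_mul_linear] matrix_vector_mult_scaleR B)
  qed
  note B_sum = this
  have "(A *v v i) \<bullet> (B *v v i) = (\<Sum>j\<in>UNIV. s i * t j * ((v i \<bullet> x j) * (u i \<bullet> y j)))" for i
    unfolding A B_sum inner_sum_right by (intro sum.cong) (simp_all add: inner_commute[of "v i"])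
  then show ?thesis unfolding matrix_inner_orthonormal[OF v] by simp
qed

lemma svd_inner_le:
  fixes A B :: "real^'l^'n"
  shows "4 * (A \<bullet> B) \<le> 2 * (phi A \<bullet> phi B) + A \<bullet> A + B \<bullet> B"
proof -
  obtain v s u where svA: "is_svd A v s u" using svd_exists by blast
  obtain x t y where svB: "is_svd B x t y" using svd_exists by blast
  have s: "\<And>i. 0 \<le> s i" and t: "\<And>j. 0 \<le> t j" using svA svB by (auto simp: is_svd_def)
  have v: "orthonormal_on UNIV v" and x: "orthonormal_on UNIV x" using svA svB by (auto simp: is_svd_def)
  let ?p = "\<lambda>i j. v i \<bullet> x j" and ?q = "\<lambda>i j. u i \<bullet> y j"
  have AB: "A \<bullet> B = (\<Sum>i\<in>UNIV. \<Sum>j\<in>UNIV. s i * t j * (?p i j * ?q i j))"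
    using svA svB by (intro inner_double_expansion[OF v x]) (auto simp: is_svd_def)
  \<comment> \<open>The same expansion, with \<open>v\<close> and \<open>x\<close> also in the roles
    of \<open>u\<close> and \<open>y\<close>.\<close>
  have PQ: "phi A \<bullet> phi B = (\<Sum>i\<in>UNIV. \<Sum>j\<in>UNIV. s i * t j * (?p i j * ?p i j))"
    by (intro inner_double_expansion[OF v x]) (auto simp: svd_phi_eigen[OF svA] svd_phi_eigen[OF svB])
  have u1: "norm (u i) \<le> 1" and y1: "norm (y i) \<le> 1" for i
    using svA svB by (auto simp: is_svd_def norm_eq_sqrt_inner)
  have bes1: "(\<Sum>j\<in>UNIV. (?q i j)\<^sup>2) \<le> 1" for i
  proof -
    have "(\<Sum>j\<in>UNIV. (y j \<bullet> u i)\<^sup>2) \<le> (norm (u i))\<^sup>2"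
      using svB by (intro bessel_partial_orthonormal[of y "{i. t i \<noteq> 0}"]) (auto simp: is_svd_def)
    also have "\<dots> \<le> 1" using u1 by (simp add: power_le_one)
    finally show ?thesis by (simp add: inner_commute)
  qed
  have bes2: "(\<Sum>i\<in>UNIV. (?q i j)\<^sup>2) \<le> 1" for j
  proof -
    have "(\<Sum>i\<in>UNIV. (u i \<bullet> y j)\<^sup>2) \<le> (norm (y j))\<^sup>2"
      using svA by (intro bessel_partial_orthonormal[of u "{i. s i \<noteq> 0}"]) (auto simp: is_svd_def)
    also have "\<dots> \<le> 1" using y1 by (simp add: power_le_one)
    finally show ?thesis .
  qed
  have "4 * (s i * t j * (?p i j * ?q i j))
      \<le> 2 * (s i * t j * (?p i j * ?p i j)) + ((s i)\<^sup>2 * (?q i j)\<^sup>2 + (t j)\<^sup>2 * (?q i j)\<^sup>2)" for i j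
  proof -
    \<comment> \<open>The terms \<open>2 * s i * t j * (?q i j)\<^sup>2\<close> from the two squares
      cancel, which leaves exactly the termwise bound.\<close>
    have "0 \<le> 2 * (s i * t j) * (?p i j - ?q i j)\<^sup>2 + (s i - t j)\<^sup>2 * (?q i j)\<^sup>2"
      using s t by simp
    then show ?thesis by (simp add: power2_eq_square algebra_simps)
  qed
  then have "(\<Sum>i\<in>UNIV. \<Sum>j\<in>UNIV. 4 * (s i * t j * (?p i j * ?q i j)))
      \<le> (\<Sum>i\<in>UNIV. \<Sum>j\<in>UNIV. 2 * (s i * t j * (?p i j * ?p i j)) + ((s i)\<^sup>2 * (?q i j)\<^sup>2 + (t j)\<^sup>2 * (?q i j)\<^sup>2))"
    by (intro sum_mono)
  then have "4 * (A \<bullet> B) \<le> 2 * (phi A \<bullet> phi B)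
      + ((\<Sum>i\<in>UNIV. \<Sum>j\<in>UNIV. (s i)\<^sup>2 * (?q i j)\<^sup>2) + (\<Sum>i\<in>UNIV. \<Sum>j\<in>UNIV. (t j)\<^sup>2 * (?q i j)\<^sup>2))"
    unfolding AB PQ sum_distrib_left by (simp add: sum.distrib)
  moreover have "(\<Sum>i\<in>UNIV. \<Sum>j\<in>UNIV. (s i)\<^sup>2 * (?q i j)\<^sup>2) \<le> A \<bullet> A"
    unfolding svd_inner_self[OF svA] sum_distrib_left[symmetric]
    using bes1 by (intro sum_mono) (simp add: mult_left_le)
  moreover have "(\<Sum>i\<in>UNIV. \<Sum>j\<in>UNIV. (t j)\<^sup>2 * (?q i j)\<^sup>2) \<le> B \<bullet> B"
    unfolding svd_inner_self[OF svB] using bes2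
    by (subst sum.swap) (auto intro!: sum_mono simp: mult_left_le simp flip: sum_distrib_left)
  ultimately show ?thesis by linarith
qed

lemma dist_phi_le: "dist (phi A) (phi B) \<le> sqrt 2 * dist A B"
proof -
  have "(norm (phi A - phi B))\<^sup>2 \<le> 2 * (norm (A - B))\<^sup>2"
    using svd_inner_le[of A B] phi_inner_self[of A] phi_inner_self[of B]
    by (simp add: power2_norm_eq_inner inner_diff_left inner_diff_right inner_commute)
  then have "norm (phi A - phi B) \<le> sqrt (2 * (norm (A - B))\<^sup>2)" by (rule real_le_rsqrt)
  then show ?thesis by (simp add: dist_norm real_sqrt_mult)
qed

lemma transpose_mult_orthogonal:
  fixes A :: "real^'l^'n"
  assumes "orthogonal_matrix g"
  shows "transpose (g ** A) ** (g ** A) = transpose A ** A"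
proof -
  have "transpose (g ** A) ** (g ** A) = transpose A ** ((transpose g ** g) ** A)"
    by (simp only: matrix_transpose_mul matrix_mul_assoc)
  also have "transpose g ** g = mat 1" using assms by (simp only: orthogonal_matrix_def)
  finally show ?thesis by (simp only: matrix_mul_lid)
qed

lemma phi_orthogonal_mult:
  assumes "orthogonal_matrix g"
  shows "phi (g ** A) = phi A"
  by (simp add: phi_def transpose_mult_orthogonal[OF assms])

subsection \<open>Orthogonal polar factors\<close>

text \<open>The matrix carries the basis \<open>z\<close> to the basis \<open>w\<close>, and its
  transpose carries \<open>w\<close> back to \<open>z\<close>.\<close>

lemma orthogonal_matrix_outer_sum:
  fixes w z :: "'n::finite \<Rightarrow> real^'n"
  assumes w: "orthonormal_on UNIV w" and z: "orthonormal_on UNIV z"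
  shows "orthogonal_matrix (outer_sum (\<lambda>_. 1) w z)"
proof -
  let ?g = "outer_sum (\<lambda>_. 1) w z"
  have gz: "?g *v z i = w i" for i by (simp add: outer_sum_mult_orthonormal[OF z])
  have gw: "transpose ?g *v w i = z i" for i
    unfolding transpose_outer_sum by (simp add: outer_sum_mult_orthonormal[OF w])
  have "transpose ?g ** ?g = mat 1"
    by (rule matrix_eqI_orthonormal[OF z])
      (simp add: gz gw matrix_vector_mul_assoc[symmetric] del: transpose_matrix_vector)
  then show ?thesis by (simp add: orthogonal_matrix)
qed

text \<open>The contraction is the transpose of a partial isometry \<open>V\<close> with \<open>A = V ** phi A\<close>.\<close>

lemma phi_eq_contraction_mult:
  fixes A :: "real^'l^'n"
  shows "\<exists>K. phi A = K ** A \<and> (\<forall>x. norm (K *v x) \<le> norm x)"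
proof -
  obtain v s u where svd: "is_svd A v s u" using svd_exists by blast
  then have v: "orthonormal_on UNIV v" by (simp add: is_svd_def)
  let ?K = "outer_sum (\<lambda>_. 1) v u"
  have "phi A = ?K ** A"
  proof (rule matrix_eqI_orthonormal[OF v])
    fix i
    have "?K *v (A *v v i) = (\<Sum>j\<in>UNIV. if j = i then s i *\<^sub>R v i else 0)"
      unfolding outer_sum_mult_vec using svd by (intro sum.cong) (auto simp: is_svd_def)
    then show "phi A *v v i = (?K ** A) *v v i"
      by (simp add: svd_phi_eigen[OF svd] flip: matrix_vector_mul_assoc)
  qed
  moreover have "norm (?K *v x) \<le> norm x" for x
  proof -
    have vK: "v i \<bullet> (?K *v x) = u i \<bullet> x" for i
    proof -
      have "v i \<bullet> (?K *v x) = (\<Sum>j\<in>UNIV. if j = i then u j \<bullet> x else 0)"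
        unfolding outer_sum_mult_vec inner_sum_right
        using v by (intro sum.cong) (auto simp: orthonormal_on_def)
      then show ?thesis by simp
    qed
    have "(norm (?K *v x))\<^sup>2 = (\<Sum>i\<in>UNIV. (u i \<bullet> x)\<^sup>2)"
      unfolding power2_norm_eq_inner orthonormal_parseval[OF v, of "?K *v x" "?K *v x", symmetric]
      by (simp add: vK power2_eq_square)
    also have "\<dots> \<le> (norm x)\<^sup>2"
      using svd by (intro bessel_partial_orthonormal[of u "{i. s i \<noteq> 0}"]) (auto simp: is_svd_def)
    finally show ?thesis by (rule power2_le_imp_le) simp
  qed
  ultimately show ?thesis by blast
qed

text \<open>Right multiplication by \<open>A\<close> has right multiplication by
  \<open>transpose A\<close> as its adjoint; this makes \<open>B ** transpose A\<close>
  appear.\<close>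

lemma inner_matrix_mult_right:
  fixes A :: "real^'l^'n" and B :: "real^'l^'m" and g :: "real^'n^'m"
  shows "(g ** A) \<bullet> B = g \<bullet> (B ** transpose A)"
proof -
  have "(g ** A) \<bullet> B = (\<Sum>i\<in>UNIV. \<Sum>j\<in>UNIV. \<Sum>k\<in>UNIV. g $ i $ k * A $ k $ j * B $ i $ j)"
    by (simp add: inner_vec_def matrix_matrix_mult_def sum_distrib_right)
  also have "\<dots> = (\<Sum>i\<in>UNIV. \<Sum>k\<in>UNIV. \<Sum>j\<in>UNIV. g $ i $ k * A $ k $ j * B $ i $ j)"
    by (intro sum.cong refl sum.swap)
  also have "\<dots> = g \<bullet> (B ** transpose A)"
    by (simp add: inner_vec_def matrix_matrix_mult_def transpose_def sum_distrib_left mult_ac)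
  finally show ?thesis .
qed

theorem orthogonal_inner_ge_phi:
  fixes A B :: "real^'l^'n"
  shows "\<exists>g. orthogonal_matrix g \<and> phi A \<bullet> phi B \<le> (g ** A) \<bullet> B"
proof -
  obtain K where K: "phi A = K ** A" "\<And>x. norm (K *v x) \<le> norm x"
    using phi_eq_contraction_mult by blast
  obtain L where L: "phi B = L ** B" "\<And>x. norm (L *v x) \<le> norm x"
    using phi_eq_contraction_mult by blast
  define M where "M = B ** transpose A"
  obtain z s w where svd: "is_svd M z s w" using svd_exists by blast
  then have z: "orthonormal_on UNIV z" and s: "\<And>k. 0 \<le> s k" and Mz: "\<And>k. M *v z k = s k *\<^sub>R w k"
    and ww: "\<And>i j. w i \<bullet> w j = (if i = j \<and> s i \<noteq> 0 then 1 else 0)"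
    by (auto simp: is_svd_def)
  \<comment> \<open>Vectors \<open>w i\<close> with \<open>s i = 0\<close> vanish and must be
    replaced before \<open>g\<close> can be orthogonal; \<open>M\<close> does not see the
    replacement.\<close>
  have "orthonormal_on {i. s i \<noteq> 0} w" using ww by (auto simp: orthonormal_on_def)
  then obtain w' where w': "orthonormal_on UNIV w'" "\<forall>i\<in>{i. s i \<noteq> 0}. w' i = w i"
    using orthonormal_family_completion by blast
  define g where "g = outer_sum (\<lambda>_. 1) w' z"
  have g: "orthogonal_matrix g"
    unfolding g_def by (rule orthogonal_matrix_outer_sum[OF w'(1) z])
  have gz: "g *v z k = w' k" for k by (simp add: g_def outer_sum_mult_orthonormal[OF z])
  have w1: "norm (w k) \<le> 1" and z1: "norm (z k) = 1" for k
    using ww z by (auto simp: norm_eq_sqrt_inner orthonormal_on_def)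
  have "phi A \<bullet> phi B = K \<bullet> (L ** B ** transpose A)"
    unfolding K(1) L(1) by (rule inner_matrix_mult_right)
  also have "\<dots> = K \<bullet> (L ** M)" by (simp add: M_def matrix_mul_assoc)
  also have "\<dots> = (\<Sum>k\<in>UNIV. s k * ((K *v z k) \<bullet> (L *v w k)))"
    unfolding matrix_inner_orthonormal[OF z]
    by (simp add: Mz matrix_vector_mult_scaleR flip: matrix_vector_mul_assoc)
  \<comment> \<open>Cauchy-Schwarz: both contractions are applied to vectors of norm at most
    1.\<close>
  also have "\<dots> \<le> (\<Sum>k\<in>UNIV. s k)"
  proof (rule sum_mono)
    fix k
    have "(K *v z k) \<bullet> (L *v w k) \<le> norm (K *v z k) * norm (L *v w k)" by (rule norm_cauchy_schwarz)
    also have "\<dots> \<le> 1 * 1"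
      using K(2)[of "z k"] L(2)[of "w k"] w1[of k] z1[of k] by (intro mult_mono) auto
    finally show "s k * ((K *v z k) \<bullet> (L *v w k)) \<le> s k" using s[of k] by (simp add: mult_left_le)
  qed
  also have "\<dots> = (\<Sum>k\<in>UNIV. (g *v z k) \<bullet> (M *v z k))"
  proof (rule sum.cong)
    show "s k = (g *v z k) \<bullet> (M *v z k)" for k
      using w'(2) ww[of k k] by (cases "s k = 0") (simp_all add: gz Mz)
  qed simp
  also have "\<dots> = g \<bullet> M" by (simp add: matrix_inner_orthonormal[OF z])
  also have "\<dots> = (g ** A) \<bullet> B" by (simp add: M_def inner_matrix_mult_right)
  finally show ?thesis using g by blast
qed

section \<open>From inner products to orbit distances\<close>

lemma orthogonal_mult_inner_self:
  fixes A :: "real^'l^'n"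
  assumes "orthogonal_matrix g"
  shows "(g ** A) \<bullet> (g ** A) = A \<bullet> A"
  using phi_orthogonal_mult[OF assms, of A] phi_inner_self by metis

lemma orth_dist_le_phi:
  fixes A B :: "real^'l^'n"
  shows "orth_dist A B \<le> dist (phi A) (phi B)"
proof -
  obtain g where g: "orthogonal_matrix g" "phi A \<bullet> phi B \<le> (g ** A) \<bullet> B"
    using orthogonal_inner_ge_phi by blast
  \<comment> \<open>Both squares contain the same \<open>A \<bullet> A + B \<bullet> B\<close>, so
    only the mixed terms are compared.\<close>
  have "(norm (g ** A - B))\<^sup>2 \<le> (norm (phi A - phi B))\<^sup>2"
    using g(2) orthogonal_mult_inner_self[OF g(1), of A] phi_inner_self[of A] phi_inner_self[of B]
    by (simp add: power2_norm_eq_inner inner_diff_left inner_diff_right inner_commute)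
  then have "dist (g ** A) B \<le> dist (phi A) (phi B)"
    by (simp add: dist_norm)
  then show ?thesis
    using orth_dist_attained[of A B] g(1) unfolding frob_dist_eq_dist by force
qed

lemma phi_le_orth_dist:
  fixes A B :: "real^'l^'n"
  shows "dist (phi A) (phi B) \<le> sqrt 2 * orth_dist A B"
proof -
  obtain g where "orthogonal_matrix g" "orth_dist A B = dist (g ** A) B"
    using orth_dist_attained[of A B] unfolding frob_dist_eq_dist by blast
  then show ?thesis using dist_phi_le[of "g ** A" B] by (simp add: phi_orthogonal_mult)
qed

subsection \<open>Symmetric matrices\<close>

lemma subspace_symmetric_matrices: "subspace (symmetric_matrices :: (real^'n^'n) set)"
  by (auto simp: subspace_def symmetric_matrices_def transpose_def vec_eq_iff)

text \<open>The basis is indexed by the sets \<open>{i, j}\<close>, of cardinality 1 (diagonal) or 2 (off-diagonal).\<close>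

lemma dim_symmetric_matrices:
  "dim (symmetric_matrices :: (real^'n^'n) set) = (CARD('n) + 1) choose 2"
proof -
  define T where "T = {s :: 'n set. card s = 1} \<union> {s. card s = 2}"
  define E :: "'n set \<Rightarrow> real^'n^'n" where "E s = (\<chi> i j. if {i, j} = s then 1 else 0)" for s
  have pair: "{i, j} \<in> T" for i j by (cases "i = j") (auto simp: T_def)
  have nz: "E s \<noteq> 0" if s: "s \<in> T" for s
  proof -
    obtain i j where "s = {i, j}"
    proof -
      consider "card s = 1" | "card s = 2" using s by (auto simp: T_def)
      then show ?thesis
      proof cases
        case 1
        then obtain i where "s = {i}" by (rule card_1_singletonE)
        then have "s = {i, i}" by simp
        then show ?thesis by (rule that)
      next
        case 2
        then show ?thesis using that by (auto simp: card_2_iff)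
      qed
    qed
    then have "E s $ i $ j = 1" by (simp add: E_def)
    then show ?thesis by auto
  qed
  \<comment> \<open>Each position \<open>(i, j)\<close> lies in the support of \<open>E s\<close>
    for the single set \<open>s = {i, j}\<close>, so distinct supports are disjoint.\<close>
  have orth: "E s \<bullet> E t = 0" if "s \<noteq> t" for s t
    unfolding E_def inner_vec_def using that by (simp cong: if_cong) (intro sum.neutral ballI, simp)
  have inj: "inj_on E T"
  proof (rule inj_onI, rule ccontr)
    fix s t assume "s \<in> T" "E s = E t" "s \<noteq> t"
    then show False using orth[of s t] nz[of s] by simp
  qed
  have ind: "independent (E ` T)"
  proof (rule pairwise_orthogonal_independent)
    show "pairwise orthogonal (E ` T)"
      by (rule pairwise_imageI) (simp add: orthogonal_def orth)
    show "0 \<notin> E ` T" using nz by force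
  qed
  have sub: "E ` T \<subseteq> symmetric_matrices"
    by (auto simp: symmetric_matrices_def E_def transpose_def insert_commute)
  have spans: "symmetric_matrices \<subseteq> span (E ` T)"
  proof
    fix S :: "real^'n^'n" assume "S \<in> symmetric_matrices"
    then have sym: "S $ i $ j = S $ j $ i" for i j
      by (auto simp: symmetric_matrices_def transpose_def vec_eq_iff)
    \<comment> \<open>The description is well defined because \<open>{i, j}\<close> determines the
      pair up to order and \<open>S\<close> is symmetric.\<close>
    define c where "c s = (THE r. \<exists>i j. s = {i, j} \<and> r = S $ i $ j)" for s
    have c: "c {i, j} = S $ i $ j" for i j
      unfolding c_def by (rule the_equality) (auto simp: doubleton_eq_iff sym)
    have "S = (\<Sum>s\<in>T. c s *\<^sub>R E s)"
      by (simp add: vec_eq_iff E_def pair c if_distrib[of "\<lambda>x. _ * x"] cong: if_cong)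
    also have "\<dots> \<in> span (E ` T)"
      by (intro span_sum span_scale span_base imageI)
    finally show "S \<in> span (E ` T)" .
  qed
  have "card T = (CARD('n) choose 1) + (CARD('n) choose 2)"
    unfolding T_def using n_subsets[of "UNIV :: 'n set"]
    by (subst card_Un_disjoint) auto
  \<comment> \<open>Pascal's rule.\<close>
  then have "card (E ` T) = (CARD('n) + 1) choose 2"
    by (simp add: card_image[OF inj] numeral_2_eq_2)
  then show ?thesis using dim_unique[OF sub spans ind] by blast
qed

theorem theorem3:
  "(\<forall>A :: real^'l^'n. \<exists>!S. pos_semidef S \<and> S ** S = transpose A ** A) \<and>
   (\<forall>A B :: real^'l^'n.
      orth_dist A B \<le> frob_dist (phi A) (phi B) \<and>
      frob_dist (phi A) (phi B) \<le> sqrt 2 * orth_dist A B) \<and>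
   range (phi :: real^'l^'n \<Rightarrow> real^'l^'l) \<subseteq> symmetric_matrices \<and>
   subspace (symmetric_matrices :: (real^'l^'l) set) \<and>
   dim (symmetric_matrices :: (real^'l^'l) set) = (CARD('l) + 1) choose 2"
proof -
  have "range (phi :: real^'l^'n \<Rightarrow> real^'l^'l) \<subseteq> symmetric_matrices"
    using phi_pos_semidef by (auto simp: pos_semidef_def symmetric_matrices_def)
  then show ?thesis
    unfolding frob_dist_eq_dist
    using gram_root_ex1 orth_dist_le_phi phi_le_orth_dist subspace_symmetric_matrices dim_symmetric_matrices
    by blast
qed

end
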